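(* There are no positive integers $x, y$ with $x > y$ satisfying $$(x-y)^{x+y} = x^{x-y}.$$ *)

theory Defs
  imports Main
begin

end

theory Submission
  imports Defs
begin

text \<open>Put \<open>a = x - y\<close>. Then \<open>a ^ a\<close> divides \<open>x ^ a\<close>, so \<open>a\<close> divides \<open>x\<close> and hence
  \<open>y = a * k\<close> for some \<open>k > 0\<close>. Taking \<open>a\<close>-th roots leaves \<open>a ^ (2 * k) = k + 1\<close>, which is
  impossible both for \<open>a = 1\<close> and for \<open>a \<ge> 2\<close>.\<close>

theorem mainTheorem15:
  shows "\<not> (\<exists>x y :: nat. x > 0 \<and> y > 0 \<and> x > y \<and> (x - y) ^ (x + y) = x ^ (x - y))"
proof
  assume "\<exists>x y :: nat. x > 0 \<and> y > 0 \<and> x > y \<and> (x - y) ^ (x + y) = x ^ (x - y)"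
  then obtain x y :: nat where "y > 0" "x > y" and eq: "(x - y) ^ (x + y) = x ^ (x - y)"
    by blast
  define a where "a = x - y"
  have "a > 0" and x: "x = a + y"
    using \<open>x > y\<close> by (auto simp: a_def)
  have eq': "a ^ (a + 2 * y) = (a + y) ^ a"
    using eq by (simp add: x mult_2 add.assoc)
  have "a ^ a dvd (a + y) ^ a"
    unfolding eq'[symmetric] by (simp add: le_imp_power_dvd)
  \<comment> \<open>The common exponent \<open>a > 0\<close> cancels from the divisibility, leaving
    \<open>a dvd a + y\<close>.\<close>
  then have "a dvd y"
    using \<open>a > 0\<close> by (simp add: pow_divides_pow_iff)
  then obtain k where y: "y = a * k"
    by (auto simp: dvd_def)
  have "k > 0"
    using \<open>y > 0\<close> y by simp
  \<comment> \<open>With \<open>y = a * k\<close>, the exponent \<open>a + 2 * y\<close> in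
    \<open>eq'\<close> is a multiple of \<open>a\<close>, so both sides of \<open>eq'\<close> are
    \<open>a\<close>-th powers.\<close>
  have "(a * a ^ (2 * k)) ^ a = a ^ ((2 * k + 1) * a)"
    by (simp flip: power_mult power_Suc)
  also have "\<dots> = (a * (k + 1)) ^ a"
    using eq' by (simp add: y algebra_simps)
  finally have "a * a ^ (2 * k) = a * (k + 1)"
    using \<open>a > 0\<close> by (simp only: power_eq_iff_eq_base)
  then have root: "a ^ (2 * k) = k + 1"
    using \<open>a > 0\<close> by (simp only: mult_cancel1 neq0_conv) simp
  show False
  proof (cases "a = 1")
    case True
    then show False
      using root \<open>k > 0\<close> by simp
  next
    case False
    \<comment> \<open>Now \<open>a \<ge> 2\<close>, so \<open>a ^ (2 * k)\<close> is too large for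
      \<open>root\<close>: the bound \<open>n < 2 ^ n\<close> at \<open>n = 2 * k\<close> gives
      \<open>n + 1 \<le> 2 ^ n\<close>.\<close>
    have "k + 1 < 2 * k + 1"
      using \<open>k > 0\<close> by simp
    also have "\<dots> \<le> 2 ^ (2 * k)"
      by (metis Suc_eq_plus1 Suc_leI less_exp)
    also have "\<dots> \<le> a ^ (2 * k)"
      using False \<open>a > 0\<close> by (intro power_mono) auto
    finally show False
      using root by simp
  qed
qed

end
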